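(* Let $X: I\to Q^2_+$ be a spacelike curve parametrized by arc length $s$ with curvature $k(s)\not\equiv 0$, and let $\hat X(s,t)=f(t)X(s)$, $(s,t)\in I\times J$, $f(t)>0$, $f(0)=1$, be an evolution of $X$ by homotheties. The family $\hat X(s,t)$ is a solution to the curvature flow (CF) if and only if the curvature $k$ of $X$ is constant, $f(t)=\sqrt{2kt+1}$ and $\hat k(s,t)=k/(2kt+1)$, where $\hat k(\cdot,t)$ is the curvature of $\hat X(\cdot,t)$. In particular: 1. If $k<0$, then $X$ is an ellipse of $Q^2_+$ with curvature $k$ and it is an ancient solution, with $J=(-\infty,-\frac{1}{2k})$. At $t=-\frac1{2k}$, $\hat X^t$ collapses into the origin of $\mathbb{R}^3_1$. 2. If $k>0$, then $X$ is a hyperbola of $Q^2_+$ with curvature $k$, and $J=(-\frac1{2k},+\infty)$.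
   Context: $\mathbb{R}^3_1$ is $\mathbb{R}^3$ with the Minkowski metric $\langle u,v\rangle=-u_1v_1+u_2v_2+u_3v_3$. The light cone is $Q^2=\{p\in\mathbb{R}^3_1\setminus\{0\}:\langle p,p\rangle=0\}$ and $Q^2_+=\{p\in Q^2:p_1>0\}$. For a (smooth) spacelike curve $X$ on $Q^2$ parametrized by arc length $s$, $T=X'$ is the unit tangent field, $Y(s)$ is the unique lightlike vector orthogonal to $T(s)$ with $\langle X(s),Y(s)\rangle=1$ (the associated curve), and the curvature $k$ is defined by $T'=kX-Y$. For an arbitrary parameter, $T,Y,k$ are those obtained via arc-length reparametrization. Spacelike curves of constant curvature are (arcs of) conic sections of the cone; such a curve is called an ellipse, a parabola, or a hyperbola of $Q^2_+$ when the constant is negative, zero, or positive, respectively. A 1-parameter family of spacelike curves $\hat X:I\times J\to Q^2_+$, $J$ an interval containing $0$, with associated curves $\hat Y^t$ and curvatures $\hat k^t$, is a solution to the CF with initial condition $X$ if $\langle \frac{\partial}{\partial t}\hat X^t,\hat Y^t\rangle=\hat k^t$ and $\hat X^0=X$. In items 1 and 2, $J$ is the maximal time interval on which the evolution is defined. An ancient solution is one defined for $t\in(-\infty,A)$ for some $A$. Collapsing into the origin at time $t_0$ means $\hat X(s,t)\to 0$ as $t\to t_0^-$. *)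

theory Defs
  imports "HOL-Analysis.Analysis"
begin

section \<open>Minkowski space and the light cone\<close>

definition mink :: "real ^ 3 \<Rightarrow> real ^ 3 \<Rightarrow> real" where
  "mink u v = - (u $ 1 * v $ 1) + u $ 2 * v $ 2 + u $ 3 * v $ 3"

definition light_cone :: "(real ^ 3) set" where
  "light_cone = {p. p \<noteq> 0 \<and> mink p p = 0}"

definition light_cone_plus :: "(real ^ 3) set" where
  "light_cone_plus = {p \<in> light_cone. p $ 1 > 0}"


section \<open>Smooth curves on intervals\<close>

text \<open>Intervals may be open, closed or half-open, bounded or not, but not a single point.
  All derivatives are taken within the interval, hence one-sided at endpoints that belong to it.\<close>

definition nondegenerate_interval :: "real set \<Rightarrow> bool" where
  "nondegenerate_interval I \<longleftrightarrow> is_interval I \<and> interior I \<noteq> {}"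

definition smooth_curve :: "real set \<Rightarrow> (real \<Rightarrow> 'a::real_normed_vector) \<Rightarrow> bool" where
  "smooth_curve I X \<longleftrightarrow>
     (\<exists>D :: nat \<Rightarrow> real \<Rightarrow> 'a. (\<forall>s\<in>I. D 0 s = X s) \<and>
        (\<forall>n. \<forall>s\<in>I. (D n has_vector_derivative D (Suc n) s) (at s within I)))"

definition velocity :: "real set \<Rightarrow> (real \<Rightarrow> 'a::real_normed_vector) \<Rightarrow> real \<Rightarrow> 'a" where
  "velocity I X s = vector_derivative X (at s within I)"

definition spacelike_curve :: "real set \<Rightarrow> (real \<Rightarrow> real ^ 3) \<Rightarrow> bool" where
  "spacelike_curve I X \<longleftrightarrow>
     nondegenerate_interval I \<and> smooth_curve I X \<and> X ` I \<subseteq> light_cone \<and>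
     (\<forall>s\<in>I. mink (velocity I X s) (velocity I X s) > 0)"

definition arc_length_curve :: "real set \<Rightarrow> (real \<Rightarrow> real ^ 3) \<Rightarrow> bool" where
  "arc_length_curve I X \<longleftrightarrow>
     spacelike_curve I X \<and> (\<forall>s\<in>I. mink (velocity I X s) (velocity I X s) = 1)"


section \<open>Associated curve and curvature\<close>

text \<open>For a curve parametrized by arc length, \<open>velocity I X\<close> is the unit tangent field \<open>T\<close>.\<close>

definition arc_length_associated :: "real set \<Rightarrow> (real \<Rightarrow> real ^ 3) \<Rightarrow> real \<Rightarrow> real ^ 3" where
  "arc_length_associated I X s =
     (THE y. y \<in> light_cone \<and> mink (velocity I X s) y = 0 \<and> mink (X s) y = 1)"

definition arc_length_curvature :: "real set \<Rightarrow> (real \<Rightarrow> real ^ 3) \<Rightarrow> real \<Rightarrow> real" where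
  "arc_length_curvature I X s =
     (THE \<kappa>. velocity I (velocity I X) s = \<kappa> *\<^sub>R X s - arc_length_associated I X s)"

text \<open>\<open>X \<circ> \<phi>\<close>, defined on the interval \<open>L\<close>, is an orientation-preserving reparametrization
  of \<open>X\<close> by arc length.\<close>

definition arc_length_reparam ::
    "real set \<Rightarrow> (real \<Rightarrow> real ^ 3) \<Rightarrow> real set \<Rightarrow> (real \<Rightarrow> real) \<Rightarrow> bool" where
  "arc_length_reparam I X L \<phi> \<longleftrightarrow>
     nondegenerate_interval L \<and> smooth_curve L \<phi> \<and> \<phi> ` L = I \<and>
     (\<forall>\<sigma>\<in>L. velocity L \<phi> \<sigma> > 0) \<and> arc_length_curve L (X \<circ> \<phi>)"

text \<open>For an arbitrary parameter. The values do not depend on the reparametrization, since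
  two of them differ by a translation of the arc-length parameter.\<close>

definition associated_curve :: "real set \<Rightarrow> (real \<Rightarrow> real ^ 3) \<Rightarrow> real \<Rightarrow> real ^ 3" where
  "associated_curve I X s =
     (THE y. \<exists>L \<phi> \<sigma>. arc_length_reparam I X L \<phi> \<and> \<sigma> \<in> L \<and> \<phi> \<sigma> = s \<and>
        y = arc_length_associated L (X \<circ> \<phi>) \<sigma>)"

definition curvature :: "real set \<Rightarrow> (real \<Rightarrow> real ^ 3) \<Rightarrow> real \<Rightarrow> real" where
  "curvature I X s =
     (THE \<kappa>. \<exists>L \<phi> \<sigma>. arc_length_reparam I X L \<phi> \<and> \<sigma> \<in> L \<and> \<phi> \<sigma> = s \<and>
        \<kappa> = arc_length_curvature L (X \<circ> \<phi>) \<sigma>)"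


section \<open>Curves of constant curvature\<close>

text \<open>An arc of a conic section of the cone: the intersection with an affine plane not through
  the origin. (The Minkowski form is nondegenerate, so every affine plane is a level set
  of some \<open>\<lambda>p. mink p n\<close>.)\<close>

definition conic_section_arc :: "real set \<Rightarrow> (real \<Rightarrow> real ^ 3) \<Rightarrow> bool" where
  "conic_section_arc I X \<longleftrightarrow>
     X ` I \<subseteq> light_cone_plus \<and> (\<exists>n d. d \<noteq> 0 \<and> (\<forall>s\<in>I. mink (X s) n = d))"

definition constant_curvature_conic :: "real set \<Rightarrow> (real \<Rightarrow> real ^ 3) \<Rightarrow> real \<Rightarrow> bool" where
  "constant_curvature_conic I X c \<longleftrightarrow>
     spacelike_curve I X \<and> conic_section_arc I X \<and> (\<forall>s\<in>I. curvature I X s = c)"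

text \<open>The type of the conic is, by convention, named after the sign of its constant curvature.\<close>

definition ellipse_of_curvature :: "real set \<Rightarrow> (real \<Rightarrow> real ^ 3) \<Rightarrow> real \<Rightarrow> bool" where
  "ellipse_of_curvature I X c \<longleftrightarrow> constant_curvature_conic I X c \<and> c < 0"

definition hyperbola_of_curvature :: "real set \<Rightarrow> (real \<Rightarrow> real ^ 3) \<Rightarrow> real \<Rightarrow> bool" where
  "hyperbola_of_curvature I X c \<longleftrightarrow> constant_curvature_conic I X c \<and> c > 0"


section \<open>The curvature flow\<close>

text \<open>Families are written \<open>F s t\<close> with curve parameter \<open>s\<close> and time \<open>t\<close>.
  Joint smoothness: \<open>D i j\<close> is the partial derivative of order \<open>i\<close> in \<open>s\<close> and \<open>j\<close> in \<open>t\<close>;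
  all of them exist and are jointly continuous.\<close>

definition smooth_family ::
    "real set \<Rightarrow> real set \<Rightarrow> (real \<Rightarrow> real \<Rightarrow> 'a::real_normed_vector) \<Rightarrow> bool" where
  "smooth_family I J F \<longleftrightarrow>
     (\<exists>D :: nat \<Rightarrow> nat \<Rightarrow> real \<Rightarrow> real \<Rightarrow> 'a.
        (\<forall>s\<in>I. \<forall>t\<in>J. D 0 0 s t = F s t) \<and>
        (\<forall>i j. continuous_on (I \<times> J) (\<lambda>(s, t). D i j s t) \<and>
           (\<forall>s\<in>I. \<forall>t\<in>J.
              ((\<lambda>s'. D i j s' t) has_vector_derivative D (Suc i) j s t) (at s within I) \<and>
              ((\<lambda>t'. D i j s t') has_vector_derivative D i (Suc j) s t) (at t within J))))"

definition spacelike_family ::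
    "real set \<Rightarrow> real set \<Rightarrow> (real \<Rightarrow> real \<Rightarrow> real ^ 3) \<Rightarrow> bool" where
  "spacelike_family I J F \<longleftrightarrow>
     nondegenerate_interval I \<and> nondegenerate_interval J \<and> 0 \<in> J \<and> smooth_family I J F \<and>
     (\<forall>t\<in>J. spacelike_curve I (\<lambda>s. F s t) \<and> (\<lambda>s. F s t) ` I \<subseteq> light_cone_plus)"

definition CF_solution ::
    "real set \<Rightarrow> real set \<Rightarrow> (real \<Rightarrow> real \<Rightarrow> real ^ 3) \<Rightarrow> (real \<Rightarrow> real ^ 3) \<Rightarrow> bool" where
  "CF_solution I J F X \<longleftrightarrow>
     spacelike_family I J F \<and>
     (\<forall>s\<in>I. \<forall>t\<in>J. mink (vector_derivative (\<lambda>t'. F s t') (at t within J))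
                       (associated_curve I (\<lambda>s'. F s' t) s)
                    = curvature I (\<lambda>s'. F s' t) s) \<and>
     (\<forall>s\<in>I. F s 0 = X s)"

text \<open>\<open>J\<close> is the maximal time interval: the solution has no proper extension in time.\<close>

definition maximal_CF_solution ::
    "real set \<Rightarrow> real set \<Rightarrow> (real \<Rightarrow> real \<Rightarrow> real ^ 3) \<Rightarrow> (real \<Rightarrow> real ^ 3) \<Rightarrow> bool" where
  "maximal_CF_solution I J F X \<longleftrightarrow>
     CF_solution I J F X \<and>
     (\<forall>J' G. CF_solution I J' G X \<and> J \<subseteq> J' \<and> (\<forall>s\<in>I. \<forall>t\<in>J. G s t = F s t) \<longrightarrow> J' = J)"

definition ancient_CF_solution ::
    "real set \<Rightarrow> real set \<Rightarrow> (real \<Rightarrow> real \<Rightarrow> real ^ 3) \<Rightarrow> (real \<Rightarrow> real ^ 3) \<Rightarrow> bool" where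
  "ancient_CF_solution I J F X \<longleftrightarrow> CF_solution I J F X \<and> (\<exists>A. J = {..<A})"

definition collapses_into_origin :: "real set \<Rightarrow> (real \<Rightarrow> real \<Rightarrow> real ^ 3) \<Rightarrow> real \<Rightarrow> bool" where
  "collapses_into_origin I F t0 \<longleftrightarrow> (\<forall>s\<in>I. ((\<lambda>t. F s t) \<longlongrightarrow> 0) (at_left t0))"

end

theory Submission
  imports Defs
begin

text \<open>Differentiating \<open>\<langle>X, X\<rangle> = 0\<close> and \<open>\<langle>T, T\<rangle> = 1\<close> shows that \<open>N = T'\<close> satisfies \<open>\<langle>X, N\<rangle> = -1\<close> and
  \<open>\<langle>T, N\<rangle> = 0\<close>, whence \<open>k = -\<langle>N, N\<rangle>/2\<close> and \<open>Y = k X - N\<close>. The homothetic curve \<open>a X\<close> has associated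
  curve \<open>Y/a\<close> and curvature \<open>k/a\<^sup>2\<close>, so the flow equation for \<open>f X\<close> reads \<open>f f' = k\<close>, that is,
  \<open>(f\<^sup>2)' = 2k\<close>. A solution cannot be continued, homothetically or not, past the zero of
  \<open>2kt + 1\<close>: there it would have to pass through the origin, which is not on the light cone.\<close>

section \<open>The Minkowski form\<close>

text \<open>Through the interpretation below, the form acquires its expansion rules and the product
  rule, on which all frame computations rest.\<close>

lemma bounded_bilinear_mink: "bounded_bilinear mink"
  unfolding bilinear_conv_bounded_bilinear[symmetric] bilinear_def
  by (auto intro!: linearI simp: mink_def algebra_simps)

interpretation mink: bounded_bilinear mink
  by (rule bounded_bilinear_mink)

lemma mink_commute: "mink u v = mink v u"
  by (simp add: mink_def mult.commute)

text \<open>If the first coordinate of a null vector vanishes, so does the sum of squares of the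
  other two. This permits division by \<open>p $ 1\<close>.\<close>

lemma light_cone_fst_nonzero:
  assumes "p \<in> light_cone"
  shows "p $ 1 \<noteq> 0"
proof
  assume p1: "p $ 1 = 0"
  with assms have "p $ 2 * p $ 2 + p $ 3 * p $ 3 = 0"
    by (simp add: light_cone_def mink_def)
  then have "p $ 2 = 0" "p $ 3 = 0"
    by (simp_all add: sum_squares_eq_zero_iff)
  with p1 have "p = 0"
    by (simp add: vec_eq_iff forall_3)
  with assms show False
    by (simp add: light_cone_def)
qed

text \<open>The plane orthogonal to \<open>p\<close> is degenerate with radical spanned by
  \<open>p\<close>. Modulo \<open>p\<close> it is a line carrying a definite form and spanned by
  \<open>T\<close>, so orthogonality to \<open>T\<close> forces \<open>z\<close> into the radical.
  This yields uniqueness of the associated curve and later determines the derivative of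
  \<open>N\<close>.\<close>

lemma orthogonal_lightlike_spacelike:
  assumes p: "p \<in> light_cone" and pT: "mink p T = 0" and TT: "mink T T \<noteq> 0"
    and zp: "mink p z = 0" and zT: "mink T z = 0"
  shows "\<exists>a. z = a *\<^sub>R p"
proof -
  have p1: "p $ 1 \<noteq> 0" by (rule light_cone_fst_nonzero[OF p])
  have pp: "p $ 1 * p $ 1 = p $ 2 * p $ 2 + p $ 3 * p $ 3"
    using p by (simp add: light_cone_def mink_def)
  have T1: "p $ 1 * T $ 1 = p $ 2 * T $ 2 + p $ 3 * T $ 3"
    using pT by (simp add: mink_def)
  have z1: "p $ 1 * z $ 1 = p $ 2 * z $ 2 + p $ 3 * z $ 3"
    using zp by (simp add: mink_def)
  \<comment> \<open>On the plane orthogonal to \<open>p\<close> the form is the pullback of \<open>(u, v) \<mapsto> u v\<close> under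
    \<open>z \<mapsto> (p\<^sub>2 z\<^sub>3 - p\<^sub>3 z\<^sub>2) / p\<^sub>1\<close>.\<close>
  have form: "(p $ 1)\<^sup>2 * mink u v
      = (p $ 2 * u $ 3 - p $ 3 * u $ 2) * (p $ 2 * v $ 3 - p $ 3 * v $ 2)"
    if "p $ 1 * u $ 1 = p $ 2 * u $ 2 + p $ 3 * u $ 3"
      "p $ 1 * v $ 1 = p $ 2 * v $ 2 + p $ 3 * v $ 3" for u v
  proof -
    have "(p $ 1)\<^sup>2 * mink u v = - (p $ 1 * u $ 1) * (p $ 1 * v $ 1)
        + (p $ 1 * p $ 1) * (u $ 2 * v $ 2 + u $ 3 * v $ 3)"
      by (simp add: mink_def power2_eq_square algebra_simps)
    then show ?thesis
      unfolding that pp by (simp add: algebra_simps)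
  qed
  have "p $ 2 * T $ 3 - p $ 3 * T $ 2 \<noteq> 0"
    using form[OF T1 T1] TT p1 by auto
  then have z23: "p $ 2 * z $ 3 = p $ 3 * z $ 2"
    using form[OF T1 z1] zT by auto
  \<comment> \<open>By \<open>z23\<close> the last two coordinates of \<open>z\<close> and
    \<open>p\<close> are proportional. The extra factor \<open>p $ 1\<close> brings the goals within
    reach of \<open>pp\<close> and \<open>z1\<close> and is cancelled afterwards.\<close>
  have "p $ 1 * (p $ 1 * z $ 2) = p $ 1 * (z $ 1 * p $ 2)"
    "p $ 1 * (p $ 1 * z $ 3) = p $ 1 * (z $ 1 * p $ 3)"
    using pp z1 z23 by algebra+
  then have "z = (z $ 1 / p $ 1) *\<^sub>R p"
    using p1 by (simp add: vec_eq_iff forall_3 field_simps)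
  then show ?thesis ..
qed

lemma light_cone_scaleR:
  assumes "a \<noteq> 0"
  shows "a *\<^sub>R p \<in> light_cone \<longleftrightarrow> p \<in> light_cone"
  using assms by (simp add: light_cone_def mink.scaleR_left mink.scaleR_right)

lemma light_cone_plus_scaleR:
  assumes "a > 0"
  shows "a *\<^sub>R p \<in> light_cone_plus \<longleftrightarrow> p \<in> light_cone_plus"
  using assms by (simp add: light_cone_plus_def light_cone_scaleR zero_less_mult_iff)


section \<open>Derivatives on intervals\<close>

text \<open>A connected set with more than one point has no isolated points. Hence derivatives
  within \<open>I\<close> are unique, also at endpoints.\<close>

lemma nondegenerate_interval_nontrivial:
  assumes "nondegenerate_interval I" "s \<in> I"
  shows "at s within I \<noteq> bot"
proof -
  have "I \<noteq> {x}" for x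
    using assms by (auto simp: nondegenerate_interval_def)
  then have "s islimpt I"
    using assms by (intro connected_imp_perfect)
      (auto simp: nondegenerate_interval_def is_interval_connected_1)
  then show ?thesis
    by (simp add: trivial_limit_within)
qed

lemma velocity_eq:
  assumes "nondegenerate_interval I" "s \<in> I" "(X has_vector_derivative v) (at s within I)"
  shows "velocity I X s = v"
  unfolding velocity_def
  by (rule vector_derivative_within[OF nondegenerate_interval_nontrivial]) fact+

lemma velocity_cong:
  assumes "\<And>s. s \<in> I \<Longrightarrow> X s = Y s" "s \<in> I"
  shows "velocity I X s = velocity I Y s"
proof -
  have "(X has_vector_derivative v) (at s within I) \<longleftrightarrow>
      (Y has_vector_derivative v) (at s within I)" for v
    using assms by (metis (no_types, lifting) has_vector_derivative_transform)
  then show ?thesis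
    by (simp add: velocity_def vector_derivative_def)
qed

lemma smooth_curve_has_velocity:
  assumes "nondegenerate_interval I" "smooth_curve I X" "s \<in> I"
  shows "(X has_vector_derivative velocity I X s) (at s within I)"
proof -
  obtain D where D: "\<And>s. s \<in> I \<Longrightarrow> D 0 s = X s"
    "\<And>n s. s \<in> I \<Longrightarrow> (D n has_vector_derivative D (Suc n) s) (at s within I)"
    using assms(2) unfolding smooth_curve_def by metis
  have "(X has_vector_derivative D (Suc 0) s) (at s within I)"
    by (rule has_vector_derivative_transform[OF \<open>s \<in> I\<close> _ D(2)[OF \<open>s \<in> I\<close>]]) (simp add: D)
  with velocity_eq[OF assms(1,3) this] show ?thesis by simp
qed

lemma smooth_curve_velocity:
  assumes "nondegenerate_interval I" "smooth_curve I X"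
  shows "smooth_curve I (velocity I X)"
proof -
  obtain D where D: "\<And>s. s \<in> I \<Longrightarrow> D 0 s = X s"
    "\<And>n s. s \<in> I \<Longrightarrow> (D n has_vector_derivative D (Suc n) s) (at s within I)"
    using assms(2) unfolding smooth_curve_def by metis
  have "D 1 s = velocity I X s" if "s \<in> I" for s
  proof -
    have "velocity I X s = velocity I (D 0) s"
      by (rule velocity_cong) (simp_all add: D that)
    also have "\<dots> = D 1 s"
      using velocity_eq[OF assms(1) that D(2)[OF that]] by simp
    finally show ?thesis ..
  qed
  then show ?thesis
    unfolding smooth_curve_def using D(2) by (intro exI[of _ "\<lambda>n. D (Suc n)"]) simp
qed

section \<open>Smoothness of scaled curves, separable families and the square root\<close>

lemma smooth_curve_scaleR:
  assumes "smooth_curve I X" "\<And>s. s \<in> I \<Longrightarrow> G s = a *\<^sub>R X s"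
  shows "smooth_curve I G"
proof -
  obtain D where D: "\<And>s. s \<in> I \<Longrightarrow> D 0 s = X s"
    "\<And>n s. s \<in> I \<Longrightarrow> (D n has_vector_derivative D (Suc n) s) (at s within I)"
    using assms(1) unfolding smooth_curve_def by metis
  then show ?thesis
    unfolding smooth_curve_def using assms(2)
    by (intro exI[of _ "\<lambda>n s. a *\<^sub>R D n s"])
      (auto intro: bounded_linear.has_vector_derivative[OF bounded_linear_scaleR_right])
qed

lemma smooth_curve_compose_scale:
  assumes "smooth_curve I X" "(\<lambda>\<sigma>. b * \<sigma>) ` L \<subseteq> I"
  shows "smooth_curve L (\<lambda>\<sigma>. X (b * \<sigma>))"
proof -
  obtain D where D: "\<And>s. s \<in> I \<Longrightarrow> D 0 s = X s"
    "\<And>n s. s \<in> I \<Longrightarrow> (D n has_vector_derivative D (Suc n) s) (at s within I)"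
    using assms(1) unfolding smooth_curve_def by metis
  have "((\<lambda>\<sigma>. b ^ n *\<^sub>R D n (b * \<sigma>)) has_vector_derivative b ^ Suc n *\<^sub>R D (Suc n) (b * \<sigma>))
      (at \<sigma> within L)" if "\<sigma> \<in> L" for n \<sigma>
  proof -
    have "((\<lambda>\<sigma>. b * \<sigma>) has_vector_derivative b) (at \<sigma> within L)"
      by (auto intro!: derivative_eq_intros)
    moreover have "(D n has_vector_derivative D (Suc n) (b * \<sigma>)) (at (b * \<sigma>) within (\<lambda>\<sigma>. b * \<sigma>) ` L)"
      using assms(2) that by (intro has_vector_derivative_within_subset[OF D(2)]) auto
    ultimately have "(D n \<circ> (\<lambda>\<sigma>. b * \<sigma>) has_vector_derivative b *\<^sub>R D (Suc n) (b * \<sigma>)) (at \<sigma> within L)"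
      by (rule vector_diff_chain_within)
    from bounded_linear.has_vector_derivative[OF bounded_linear_scaleR_right this, of "b ^ n"]
    show ?thesis by (simp add: o_def mult.commute)
  qed
  moreover have "D 0 (b * \<sigma>) = X (b * \<sigma>)" if "\<sigma> \<in> L" for \<sigma>
    using D(1) assms(2) that by auto
  ultimately show ?thesis
    unfolding smooth_curve_def by (intro exI[of _ "\<lambda>n \<sigma>. b ^ n *\<^sub>R D n (b * \<sigma>)"]) simp
qed

text \<open>The variables separate: every mixed partial is a derivative of \<open>f\<close> times a
  derivative of \<open>X\<close>, so joint continuity reduces to continuity of each factor.\<close>

lemma smooth_family_scaleR:
  assumes "smooth_curve I X" "smooth_curve J f"
    and F: "\<And>s t. s \<in> I \<Longrightarrow> t \<in> J \<Longrightarrow> F s t = f t *\<^sub>R X s"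
  shows "smooth_family I J F"
proof -
  obtain D where D: "\<And>s. s \<in> I \<Longrightarrow> D 0 s = X s"
    "\<And>n s. s \<in> I \<Longrightarrow> (D n has_vector_derivative D (Suc n) s) (at s within I)"
    using assms(1) unfolding smooth_curve_def by metis
  obtain E where E: "\<And>t. t \<in> J \<Longrightarrow> E 0 t = f t"
    "\<And>n t. t \<in> J \<Longrightarrow> (E n has_vector_derivative E (Suc n) t) (at t within J)"
    using assms(2) unfolding smooth_curve_def by metis
  have "continuous_on I (D i)" for i
    by (rule continuous_on_vector_derivative[OF D(2)])
  moreover have "continuous_on J (E j)" for j
    by (rule continuous_on_vector_derivative[OF E(2)])
  ultimately have "continuous_on (I \<times> J) (\<lambda>p. E j (snd p) *\<^sub>R D i (fst p))" for i j
    by (intro continuous_on_scaleR continuous_on_compose2[OF _ continuous_on_snd[OF continuous_on_id]]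
        continuous_on_compose2[OF _ continuous_on_fst[OF continuous_on_id]]) auto
  moreover have "((\<lambda>s'. E j t *\<^sub>R D i s') has_vector_derivative E j t *\<^sub>R D (Suc i) s) (at s within I)"
    if "s \<in> I" for i j s t
    by (rule bounded_linear.has_vector_derivative[OF bounded_linear_scaleR_right D(2)[OF that]])
  moreover have "((\<lambda>t'. E j t' *\<^sub>R D i s) has_vector_derivative E (Suc j) t *\<^sub>R D i s) (at t within J)"
    if "t \<in> J" for i j s t
    by (rule bounded_linear.has_vector_derivative[OF bounded_linear_scaleR_left E(2)[OF that]])
  ultimately show ?thesis
    unfolding smooth_family_def
    by (intro exI[of _ "\<lambda>i j s t. E j t *\<^sub>R D i s"]) (simp add: D E F case_prod_beta)
qed

text \<open>\<open>vector_derivative\<close> is a choice operator and carries no differentiability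
  by itself. Smoothness of the family supplies an actual derivative, so the flow equation can be
  used analytically.\<close>

lemma smooth_family_has_vector_derivative:
  assumes "smooth_family I J F" "nondegenerate_interval J" "s \<in> I" "t \<in> J"
  shows "((\<lambda>t'. F s t') has_vector_derivative vector_derivative (\<lambda>t'. F s t') (at t within J))
    (at t within J)"
proof -
  obtain v where v: "((\<lambda>t'. F s t') has_vector_derivative v) (at t within J)"
  proof -
    obtain D where D: "\<forall>s\<in>I. \<forall>t\<in>J. D 0 0 s t = F s t"
      "\<forall>i j. continuous_on (I \<times> J) (\<lambda>(s, t). D i j s t) \<and> (\<forall>s\<in>I. \<forall>t\<in>J.
        ((\<lambda>s'. D i j s' t) has_vector_derivative D (Suc i) j s t) (at s within I) \<and>
        ((\<lambda>t'. D i j s t') has_vector_derivative D i (Suc j) s t) (at t within J))"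
      using assms(1) unfolding smooth_family_def by (elim exE conjE)
    then have "((\<lambda>t'. D 0 0 s t') has_vector_derivative D 0 (Suc 0) s t) (at t within J)"
      using assms(3,4) by blast
    then have "((\<lambda>t'. F s t') has_vector_derivative D 0 (Suc 0) s t) (at t within J)"
      by (rule has_vector_derivative_transform[rotated -1]) (use D(1) assms(3,4) in auto)
    then show ?thesis by (rule that)
  qed
  show ?thesis
    using v vector_derivative_within[OF nondegenerate_interval_nontrivial[OF assms(2,4)] v] by simp
qed

lemma smooth_curve_sqrt_affine:
  assumes "\<And>t. t \<in> J \<Longrightarrow> b * t + 1 > 0" "\<And>t. t \<in> J \<Longrightarrow> f t = sqrt (b * t + 1)"
  shows "smooth_curve J f"
proof -
  \<comment> \<open>\<open>E n\<close> is the \<open>n\<close>-th derivative of the square root: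
    each differentiation contributes the current exponent \<open>1 / 2 - i\<close> and the inner
    derivative \<open>b\<close>.\<close>
  define E where
    "E n t = (\<Prod>i<n. (1 / 2 - real i) * b) * (b * t + 1) powr (1 / 2 - real n)" for n t
  have "(E n has_vector_derivative E (Suc n) t) (at t within J)" if "t \<in> J" for n t
  proof -
    have "((\<lambda>t. (b * t + 1) powr p) has_real_derivative p * (b * t + 1) powr (p - 1) * b)
        (at t within J)" for p
      using assms(1)[OF that]
      by (intro has_field_derivative_at_within[OF DERIV_cong[OF DERIV_fun_powr]])
        (auto intro!: derivative_eq_intros)
    from DERIV_cmult[OF this] show ?thesis
      unfolding E_def has_real_derivative_iff_has_vector_derivative[symmetric]
      by (rule DERIV_cong) (simp add: algebra_simps)
  qed
  moreover have "E 0 t = f t" if "t \<in> J" for t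
    using assms that by (simp add: E_def powr_half_sqrt less_imp_le)
  ultimately show ?thesis
    unfolding smooth_curve_def by blast
qed


section \<open>Frames of curves on the light cone\<close>

text \<open>Two candidates for the associated vector differ by a vector orthogonal to
  \<open>X\<close> and \<open>T\<close>, hence by a multiple \<open>a X\<close>; adding it changes
  the square by \<open>2 a\<close>, so lightlikeness forces \<open>a = 0\<close>. Assuming only the
  pointwise relations lets the lemma serve both \<open>X\<close> and reparametrized multiples of
  it.\<close>

lemma arc_length_frame:
  fixes I :: "real set" and X :: "real \<Rightarrow> real ^ 3"
  defines "T \<equiv> velocity I X"
  defines "N \<equiv> velocity I T"
  assumes X: "X s \<in> light_cone" and XT: "mink (X s) (T s) = 0" and TT: "mink (T s) (T s) = 1"
    and XN: "mink (X s) (N s) = - 1" and TN: "mink (T s) (N s) = 0"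
  shows "arc_length_associated I X s = (- mink (N s) (N s) / 2) *\<^sub>R X s - N s"
    and "arc_length_curvature I X s = - mink (N s) (N s) / 2"
proof -
  define \<kappa> where "\<kappa> = - mink (N s) (N s) / 2"
  define y where "y = \<kappa> *\<^sub>R X s - N s"
  have XX: "mink (X s) (X s) = 0" and X0: "X s \<noteq> 0"
    using X by (auto simp: light_cone_def)
  note mink_simps = mink.diff_left mink.diff_right mink.add_left mink.add_right
    mink.scaleR_left mink.scaleR_right
  have Xy: "mink (X s) y = 1" and Ty: "mink (T s) y = 0" and yy: "mink y y = 0"
    using XX XT XN TN mink_commute[of "T s" "X s"] mink_commute[of "N s" "X s"]
    by (simp_all add: y_def mink_simps) (simp add: \<kappa>_def)
  have y: "y \<in> light_cone"
    using yy Xy by (auto simp: light_cone_def mink.zero_right)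
  have unique: "z = y" if z: "z \<in> light_cone" "mink (T s) z = 0" "mink (X s) z = 1" for z
  proof -
    obtain a where a: "z - y = a *\<^sub>R X s"
      using orthogonal_lightlike_spacelike[OF X XT, of "z - y"] TT z Xy Ty
      by (auto simp: mink_simps)
    then have zy: "z = y + a *\<^sub>R X s" by (simp add: algebra_simps)
    have "mink z z = 2 * a"
      unfolding zy using XX Xy yy mink_commute[of y "X s"] by (simp add: mink_simps)
    with z zy show ?thesis by (simp add: light_cone_def)
  qed
  show assoc: "arc_length_associated I X s = (- mink (N s) (N s) / 2) *\<^sub>R X s - N s"
    unfolding arc_length_associated_def T_def[symmetric] \<kappa>_def[symmetric] y_def[symmetric]
    by (rule the_equality) (use y Xy Ty in simp, metis unique)
  show "arc_length_curvature I X s = - mink (N s) (N s) / 2"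
    unfolding arc_length_curvature_def assoc T_def[symmetric] N_def[symmetric]
  proof (rule the_equality)
    fix \<kappa>' assume "N s = \<kappa>' *\<^sub>R X s - ((- mink (N s) (N s) / 2) *\<^sub>R X s - N s)"
    then have "\<kappa>' *\<^sub>R X s = (- mink (N s) (N s) / 2) *\<^sub>R X s"
      by (simp add: eq_neg_iff_add_eq_0)
    then show "\<kappa>' = - mink (N s) (N s) / 2"
      unfolding scaleR_cancel_right using X0 by blast
  qed simp
qed

section \<open>The moving frame of an arc-length curve\<close>

locale cone_curve =
  fixes I :: "real set" and X :: "real \<Rightarrow> real ^ 3"
  assumes arc_length: "arc_length_curve I X"
begin

definition T where "T = velocity I X"
definition N where "N = velocity I T"
text \<open>For \<open>Y = \<kappa> X - N\<close> one has \<langle>Y, Y\<rangle> = 2 \<kappa> +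
  \<langle>N, N\<rangle>, so this is the value that makes \<open>Y\<close> lightlike. The explicit
  formula stands in for the definite description of the curvature.\<close>

definition \<kappa> where "\<kappa> s = - mink (N s) (N s) / 2"
definition Y where "Y s = \<kappa> s *\<^sub>R X s - N s"

lemma nondegenerate: "nondegenerate_interval I"
  and smooth: "smooth_curve I X"
  and spacelike: "spacelike_curve I X"
  and in_cone: "s \<in> I \<Longrightarrow> X s \<in> light_cone"
  and mink_TT: "s \<in> I \<Longrightarrow> mink (T s) (T s) = 1"
  using arc_length by (auto simp: arc_length_curve_def spacelike_curve_def T_def)

lemma smooth_T: "smooth_curve I T" and smooth_N: "smooth_curve I N"
  unfolding T_def N_def by (intro smooth_curve_velocity nondegenerate smooth)+

lemma deriv_X: "s \<in> I \<Longrightarrow> (X has_vector_derivative T s) (at s within I)"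
  and deriv_T: "s \<in> I \<Longrightarrow> (T has_vector_derivative N s) (at s within I)"
  and deriv_N: "s \<in> I \<Longrightarrow> (N has_vector_derivative velocity I N s) (at s within I)"
  unfolding T_def N_def
  using smooth smooth_T smooth_N nondegenerate
  by (auto intro!: smooth_curve_has_velocity simp: T_def N_def)

text \<open>The frame relations below arise from one another by differentiating constant products.
  The product rule and the zero derivative agree because derivatives within \<open>I\<close> are
  unique.\<close>

lemma mink_constant_deriv:
  assumes "\<And>s. s \<in> I \<Longrightarrow> mink (P s) (Q s) = c" "s \<in> I"
    and "(P has_vector_derivative P') (at s within I)"
    and "(Q has_vector_derivative Q') (at s within I)"
  shows "mink (P s) Q' + mink P' (Q s) = 0"
proof -
  have "((\<lambda>s. mink (P s) (Q s)) has_vector_derivative mink (P s) Q' + mink P' (Q s)) (at s within I)"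
    by (rule mink.has_vector_derivative[OF assms(3,4)])
  moreover have "((\<lambda>s. mink (P s) (Q s)) has_vector_derivative 0) (at s within I)"
    by (rule has_vector_derivative_transform[OF assms(2,1) has_vector_derivative_const])
  ultimately show ?thesis
    using velocity_eq[OF nondegenerate assms(2)] by metis
qed

lemma mink_XX: "s \<in> I \<Longrightarrow> mink (X s) (X s) = 0"
  using in_cone by (simp add: light_cone_def)

lemma mink_XT: "s \<in> I \<Longrightarrow> mink (X s) (T s) = 0"
  using mink_constant_deriv[OF mink_XX _ deriv_X deriv_X, of s] mink_commute[of "X s" "T s"]
  by simp

lemma mink_XN: "s \<in> I \<Longrightarrow> mink (X s) (N s) = - 1"
  using mink_constant_deriv[OF mink_XT _ deriv_X deriv_T, of s] mink_TT[of s]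
  by simp

lemma mink_TN: "s \<in> I \<Longrightarrow> mink (T s) (N s) = 0"
  using mink_constant_deriv[OF mink_TT _ deriv_T deriv_T, of s] mink_commute[of "T s" "N s"]
  by simp

lemma mink_XY: "s \<in> I \<Longrightarrow> mink (X s) (Y s) = 1"
  by (simp add: Y_def mink.diff_right mink.scaleR_right mink_XX mink_XN)

lemma arc_length_curvature_eq: "s \<in> I \<Longrightarrow> arc_length_curvature I X s = \<kappa> s"
  unfolding \<kappa>_def N_def T_def
  using in_cone mink_XT mink_TT mink_XN mink_TN
  by (intro arc_length_frame) (auto simp: N_def T_def)

subsection \<open>Homothetic curves\<close>

context
  fixes a :: real and G :: "real \<Rightarrow> real ^ 3"
  assumes a: "a > 0" and G: "\<And>s. s \<in> I \<Longrightarrow> G s = a *\<^sub>R X s"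
begin

text \<open>Unit speed of \<open>a X \<circ> \<phi>\<close> forces \<phi>' = 1/a. Then the tangent
  is unchanged, its derivative is divided by \<open>a\<close> and \<langle>N, N\<rangle> by a^2.
  Treating an arbitrary reparametrization gives the uniqueness half of the descriptions defining
  \<open>associated_curve\<close> and \<open>curvature\<close>.\<close>

lemma reparam_homothety:
  assumes rep: "arc_length_reparam I G L \<phi>" and \<sigma>: "\<sigma> \<in> L"
  shows "arc_length_associated L (G \<circ> \<phi>) \<sigma> = (1 / a) *\<^sub>R Y (\<phi> \<sigma>)"
    and "arc_length_curvature L (G \<circ> \<phi>) \<sigma> = \<kappa> (\<phi> \<sigma>) / a\<^sup>2"
proof -
  have L: "nondegenerate_interval L" and \<phi>: "smooth_curve L \<phi>" and img: "\<phi> ` L = I"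
    and pos: "\<And>\<sigma>. \<sigma> \<in> L \<Longrightarrow> velocity L \<phi> \<sigma> > 0"
    and unit: "\<And>\<sigma>. \<sigma> \<in> L \<Longrightarrow> mink (velocity L (G \<circ> \<phi>) \<sigma>) (velocity L (G \<circ> \<phi>) \<sigma>) = 1"
    using rep by (auto simp: arc_length_reparam_def arc_length_curve_def)
  have \<phi>I: "\<phi> \<sigma> \<in> I" if "\<sigma> \<in> L" for \<sigma>
    using img that by auto
  have d\<phi>: "(\<phi> has_vector_derivative velocity L \<phi> \<sigma>) (at \<sigma> within L)" if "\<sigma> \<in> L" for \<sigma>
    by (rule smooth_curve_has_velocity[OF L \<phi> that])
  have vel: "velocity L (G \<circ> \<phi>) \<sigma> = (a * velocity L \<phi> \<sigma>) *\<^sub>R T (\<phi> \<sigma>)" if "\<sigma> \<in> L" for \<sigma>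
  proof -
    have "(X has_vector_derivative T (\<phi> \<sigma>)) (at (\<phi> \<sigma>) within \<phi> ` L)"
      unfolding img by (rule deriv_X[OF \<phi>I[OF that]])
    from vector_diff_chain_within[OF d\<phi>[OF that] this]
    have "((\<lambda>\<sigma>. a *\<^sub>R (X \<circ> \<phi>) \<sigma>) has_vector_derivative a *\<^sub>R velocity L \<phi> \<sigma> *\<^sub>R T (\<phi> \<sigma>)) (at \<sigma> within L)"
      by (rule bounded_linear.has_vector_derivative[OF bounded_linear_scaleR_right])
    then have "((G \<circ> \<phi>) has_vector_derivative a *\<^sub>R velocity L \<phi> \<sigma> *\<^sub>R T (\<phi> \<sigma>)) (at \<sigma> within L)"
      by (rule has_vector_derivative_transform[OF that, rotated]) (simp add: G \<phi>I)
    then show ?thesis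
      using velocity_eq[OF L that] by simp
  qed
  have speed: "a * velocity L \<phi> \<sigma> = 1" if "\<sigma> \<in> L" for \<sigma>
  proof -
    \<comment> \<open>Unit length determines this factor up to sign; preservation of orientation
      selects the value 1.\<close>
    have "(a * velocity L \<phi> \<sigma>)\<^sup>2 = 1"
      using unit[OF that] unfolding vel[OF that]
      by (simp add: mink.scaleR_left mink.scaleR_right mink_TT[OF \<phi>I[OF that]] power2_eq_square)
    moreover have "a * velocity L \<phi> \<sigma> > 0" using a pos[OF that] by simp
    ultimately show ?thesis by (simp add: power2_eq_1_iff)
  qed
  have T: "velocity L (G \<circ> \<phi>) \<sigma> = T (\<phi> \<sigma>)" if "\<sigma> \<in> L" for \<sigma>
    using vel[OF that] speed[OF that] by simp
  have "velocity L (velocity L (G \<circ> \<phi>)) \<sigma> = velocity L (T \<circ> \<phi>) \<sigma>"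
    by (rule velocity_cong) (simp_all add: T \<sigma>)
  also have "\<dots> = velocity L \<phi> \<sigma> *\<^sub>R N (\<phi> \<sigma>)"
    by (intro velocity_eq[OF L \<sigma>] vector_diff_chain_within d\<phi> \<sigma>)
      (simp add: img deriv_T \<phi>I \<sigma>)
  also have "velocity L \<phi> \<sigma> = 1 / a"
    using speed[OF \<sigma>] a by (simp add: field_simps)
  finally have N: "velocity L (velocity L (G \<circ> \<phi>)) \<sigma> = (1 / a) *\<^sub>R N (\<phi> \<sigma>)" .
  note s = \<phi>I[OF \<sigma>]
  have "(G \<circ> \<phi>) \<sigma> \<in> light_cone"
    "mink ((G \<circ> \<phi>) \<sigma>) (velocity L (G \<circ> \<phi>) \<sigma>) = 0"
    "mink (velocity L (G \<circ> \<phi>) \<sigma>) (velocity L (G \<circ> \<phi>) \<sigma>) = 1"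
    "mink ((G \<circ> \<phi>) \<sigma>) (velocity L (velocity L (G \<circ> \<phi>)) \<sigma>) = - 1"
    "mink (velocity L (G \<circ> \<phi>) \<sigma>) (velocity L (velocity L (G \<circ> \<phi>)) \<sigma>) = 0"
    unfolding N T[OF \<sigma>] using a s in_cone mink_XT mink_TT mink_XN mink_TN
    by (simp_all add: G light_cone_scaleR mink.scaleR_left mink.scaleR_right)
  note frame = arc_length_frame[OF this, unfolded N]
  show "arc_length_associated L (G \<circ> \<phi>) \<sigma> = (1 / a) *\<^sub>R Y (\<phi> \<sigma>)"
    unfolding frame(1) using a
    by (simp add: G s Y_def \<kappa>_def mink.scaleR_left mink.scaleR_right scaleR_diff_right)
  show "arc_length_curvature L (G \<circ> \<phi>) \<sigma> = \<kappa> (\<phi> \<sigma>) / a\<^sup>2"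
    unfolding frame(2) by (simp add: \<kappa>_def mink.scaleR_left mink.scaleR_right power2_eq_square)
qed

lemma velocity_homothety:
  assumes "s \<in> I"
  shows "velocity I G s = a *\<^sub>R T s"
proof -
  have "((\<lambda>s. a *\<^sub>R X s) has_vector_derivative a *\<^sub>R T s) (at s within I)"
    by (rule bounded_linear.has_vector_derivative[OF bounded_linear_scaleR_right deriv_X[OF assms]])
  then show ?thesis
    by (intro velocity_eq[OF nondegenerate assms] has_vector_derivative_transform[OF assms G])
qed

lemma spacelike_homothety: "spacelike_curve I G"
  unfolding spacelike_curve_def
  using a in_cone mink_TT smooth_curve_scaleR[OF smooth G] nondegenerate
  by (auto simp: G light_cone_scaleR velocity_homothety mink.scaleR_left mink.scaleR_right)

text \<open>The existence half of the two descriptions: arc length of \<open>a X\<close> is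
  \<open>a\<close> times that of \<open>X\<close>, so \<sigma> / a is the required parameter
  change.\<close>

lemma arc_length_reparam_homothety:
  "arc_length_reparam I G ((*) a ` I) (\<lambda>\<sigma>. inverse a * \<sigma>)"
proof -
  let ?L = "(*) a ` I" and ?\<phi> = "\<lambda>\<sigma>. inverse a * \<sigma>"
  have img: "?\<phi> ` ?L = I"
    using a by (simp add: image_image mult.assoc[symmetric])
  have inv: "inverse a * (a * s) = s" for s
    using a by (simp add: mult.assoc[symmetric])
  have L: "nondegenerate_interval ?L"
  proof -
    have "connected ?L"
      using nondegenerate
      by (intro connected_continuous_image continuous_intros)
        (simp add: nondegenerate_interval_def is_interval_connected_1)
    moreover have "interior ?L = (*) a ` interior I"
      using a by (intro interior_injective_linear_image linearI injI) (auto simp: algebra_simps)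
    ultimately show ?thesis
      using nondegenerate by (simp add: nondegenerate_interval_def is_interval_connected_1)
  qed
  have d\<phi>: "(?\<phi> has_vector_derivative inverse a) (at \<sigma> within ?L)" for \<sigma>
    by (auto intro!: derivative_eq_intros)
  have "smooth_curve UNIV (\<lambda>x::real. x)"
    unfolding smooth_curve_def
    by (intro exI[of _ "\<lambda>n x. if n = 0 then x else if n = 1 then 1 else 0"]) auto
  \<comment> \<open>The parameter change is itself the identity composed with scaling by
    \<open>inverse a\<close>.\<close>
  then have \<phi>: "smooth_curve ?L ?\<phi>"
    by (rule smooth_curve_compose_scale) simp
  have vel: "velocity ?L (G \<circ> ?\<phi>) \<sigma> = T (?\<phi> \<sigma>)" if "\<sigma> \<in> ?L" for \<sigma>
  proof -
    have s: "?\<phi> \<sigma> \<in> I" using that img by blast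
    have "(G has_vector_derivative a *\<^sub>R T (?\<phi> \<sigma>)) (at (?\<phi> \<sigma>) within ?\<phi> ` ?L)"
      unfolding img velocity_homothety[OF s, symmetric]
      by (rule smooth_curve_has_velocity[OF nondegenerate smooth_curve_scaleR[OF smooth G] s])
    from velocity_eq[OF L that vector_diff_chain_within[OF d\<phi> this]] show ?thesis
      using a by simp
  qed
  have "smooth_curve ?L (G \<circ> ?\<phi>)"
    unfolding o_def
    by (rule smooth_curve_compose_scale[OF smooth_curve_scaleR[OF smooth G]]) (auto simp: inv)
  then have "arc_length_curve ?L (G \<circ> ?\<phi>)"
    unfolding arc_length_curve_def spacelike_curve_def
    using L a in_cone by (auto simp: vel mink_TT inv G light_cone_scaleR)
  then show ?thesis
    unfolding arc_length_reparam_def using L \<phi> img a velocity_eq[OF L _ d\<phi>] by auto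
qed

lemma associated_curve_homothety:
  assumes "s \<in> I"
  shows "associated_curve I G s = (1 / a) *\<^sub>R Y s"
  unfolding associated_curve_def
proof (rule the_equality)
  \<comment> \<open>In the scaled interval the parameter over \<open>s\<close> is
    \<open>a * s\<close>.\<close>
  show "\<exists>L \<phi> \<sigma>. arc_length_reparam I G L \<phi> \<and> \<sigma> \<in> L \<and> \<phi> \<sigma> = s
      \<and> (1 / a) *\<^sub>R Y s = arc_length_associated L (G \<circ> \<phi>) \<sigma>"
    using arc_length_reparam_homothety reparam_homothety(1)[OF arc_length_reparam_homothety, of "a * s"]
      assms a
    by (intro exI[of _ "(*) a ` I"] exI[of _ "\<lambda>\<sigma>. inverse a * \<sigma>"] exI[of _ "a * s"])
      (auto simp: mult.assoc[symmetric])
qed (auto simp: reparam_homothety)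

lemma curvature_homothety:
  assumes "s \<in> I"
  shows "curvature I G s = \<kappa> s / a\<^sup>2"
  unfolding curvature_def
proof (rule the_equality)
  show "\<exists>L \<phi> \<sigma>. arc_length_reparam I G L \<phi> \<and> \<sigma> \<in> L \<and> \<phi> \<sigma> = s
      \<and> \<kappa> s / a\<^sup>2 = arc_length_curvature L (G \<circ> \<phi>) \<sigma>"
    using arc_length_reparam_homothety reparam_homothety(2)[OF arc_length_reparam_homothety, of "a * s"]
      assms a
    by (intro exI[of _ "(*) a ` I"] exI[of _ "\<lambda>\<sigma>. inverse a * \<sigma>"] exI[of _ "a * s"])
      (auto simp: mult.assoc[symmetric])
qed (auto simp: reparam_homothety)

end

subsection \<open>Constant curvature\<close>

lemma curvature_eq: "s \<in> I \<Longrightarrow> curvature I X s = \<kappa> s"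
  using curvature_homothety[of 1 X s] by simp

text \<open>For constant curvature \<open>c\<close> the vector \<open>c X + Y = 2 c X - T'\<close> does not depend on \<open>s\<close>;
  it is the normal of the plane cutting out the conic.\<close>

lemma constant_curvature_conic:
  assumes plus: "X ` I \<subseteq> light_cone_plus" and c: "\<And>s. s \<in> I \<Longrightarrow> \<kappa> s = c"
  shows "constant_curvature_conic I X c"
proof -
  have NN: "mink (N s) (N s) = - 2 * c" if "s \<in> I" for s
    using c[OF that] by (simp add: \<kappa>_def)
  define M where "M = velocity I N"
  have N_deriv: "M s = (2 * c) *\<^sub>R T s" if s: "s \<in> I" for s
  proof -
    \<comment> \<open>\<open>w\<close> turns out orthogonal to \<open>X\<close> and
      \<open>T\<close>, hence a multiple of \<open>X\<close>. It is also orthogonal to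
      \<open>N\<close>, and since \<langle>X, N\<rangle> = -1 the multiple is zero.\<close>
    define w where "w = M s - (2 * c) *\<^sub>R T s"
    have "mink (X s) (M s) = 0"
      using mink_constant_deriv[OF mink_XN s deriv_X[OF s] deriv_N[OF s]] mink_TN[OF s]
      by (simp add: M_def)
    then have Xw: "mink (X s) w = 0"
      using mink_XT[OF s] by (simp add: w_def mink.diff_right mink.scaleR_right)
    have "mink (T s) (M s) = 2 * c"
      using mink_constant_deriv[OF mink_TN s deriv_T[OF s] deriv_N[OF s]] NN[OF s]
      by (simp add: M_def)
    then have Tw: "mink (T s) w = 0"
      using mink_TT[OF s] by (simp add: w_def mink.diff_right mink.scaleR_right)
    have "mink (N s) (M s) = 0"
      using mink_constant_deriv[OF NN s deriv_N[OF s] deriv_N[OF s]] mink_commute[of "N s" "M s"]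
      by (simp add: M_def)
    then have Nw: "mink (N s) w = 0"
      using mink_TN[OF s] mink_commute[of "N s" "T s"]
      by (simp add: w_def mink.diff_right mink.scaleR_right)
    obtain b where b: "w = b *\<^sub>R X s"
      using orthogonal_lightlike_spacelike[OF in_cone[OF s] mink_XT[OF s] _ Xw Tw] mink_TT[OF s]
      by auto
    have "b = 0"
      using Nw mink_XN[OF s] mink_commute[of "N s" "X s"] by (simp add: b mink.scaleR_right)
    then show ?thesis using b by (simp add: w_def)
  qed
  have "((\<lambda>s. (2 * c) *\<^sub>R X s - N s) has_vector_derivative 0) (at s within I)" if s: "s \<in> I" for s
    using has_vector_derivative_diff[OF bounded_linear.has_vector_derivative[OF
        bounded_linear_scaleR_right deriv_X[OF s], of "2 * c"] deriv_N[OF s]]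
    by (simp add: N_deriv[OF s, unfolded M_def])
  moreover have "convex I"
    using nondegenerate by (simp add: nondegenerate_interval_def is_interval_convex)
  ultimately obtain n where n: "\<And>s. s \<in> I \<Longrightarrow> (2 * c) *\<^sub>R X s - N s = n"
    using has_derivative_zero_constant[of I "\<lambda>s. (2 * c) *\<^sub>R X s - N s"]
    by (auto simp: has_vector_derivative_def)
  \<comment> \<open>The level is 1 because \<langle>X, X\<rangle> = 0 and \<langle>X, N\<rangle> =
    -1; being nonzero, it keeps the plane away from the origin.\<close>
  have "mink (X s) n = 1" if s: "s \<in> I" for s
    unfolding n[OF s, symmetric]
    using mink_XX[OF s] mink_XN[OF s] by (simp add: mink.diff_right mink.scaleR_right)
  then have "conic_section_arc I X"
    unfolding conic_section_arc_def using plus by (intro conjI exI[of _ n] exI[of _ 1]) auto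
  then show ?thesis
    unfolding constant_curvature_conic_def using spacelike c curvature_eq by auto
qed

end


section \<open>Evolution by homotheties\<close>

text \<open>Translates positivity of the radicand into the two half-lines of the theorem; the sign
  of \<open>c\<close> decides the direction.\<close>

lemma affine_positive_ray:
  fixes c :: real
  assumes "c \<noteq> 0"
  shows "{t. 2 * c * t + 1 > 0} = (if c < 0 then {..< - 1 / (2 * c)} else {- 1 / (2 * c) <..})"
proof (cases "c < 0")
  case True
  then have "t < - 1 / (2 * c) \<longleftrightarrow> - 1 < t * (2 * c)" for t
    by (intro neg_less_divide_eq) simp
  then have "2 * c * t + 1 > 0 \<longleftrightarrow> t < - 1 / (2 * c)" for t
    by (simp only: mult.commute) linarith
  with True show ?thesis by auto
next
  case False
  with assms have "- 1 / (2 * c) < t \<longleftrightarrow> - 1 < t * (2 * c)" for t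
    by (intro pos_divide_less_eq) simp
  then have "2 * c * t + 1 > 0 \<longleftrightarrow> - 1 / (2 * c) < t" for t
    by (simp only: mult.commute) linarith
  with False show ?thesis by auto
qed

text \<open>With \<open>J\<close>, \<open>f\<close> and \<open>F\<close> as parameters, the locale
  can be instantiated a second time, on the largest possible time interval, in the proof of
  maximality.\<close>

locale homothetic_evolution = cone_curve +
  fixes J :: "real set" and f :: "real \<Rightarrow> real" and F :: "real \<Rightarrow> real \<Rightarrow> real ^ 3"
  assumes plus: "X ` I \<subseteq> light_cone_plus"
    and J: "nondegenerate_interval J" "0 \<in> J"
    and f_pos: "\<And>t. t \<in> J \<Longrightarrow> f t > 0" and f0: "f 0 = 1"
    and F: "\<And>s t. s \<in> I \<Longrightarrow> t \<in> J \<Longrightarrow> F s t = f t *\<^sub>R X s"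
begin

lemma I_nonempty: "I \<noteq> {}"
  using nondegenerate by (auto simp: nondegenerate_interval_def)

lemma curvature_F: "s \<in> I \<Longrightarrow> t \<in> J \<Longrightarrow> curvature I (\<lambda>s'. F s' t) s = \<kappa> s / (f t)\<^sup>2"
  by (rule curvature_homothety) (simp_all add: f_pos F)

text \<open>The time derivative is \<open>f' X\<close> and the associated curve is
  \<open>Y / f\<close>, while \<langle>X, Y\<rangle> = 1.\<close>

lemma flow_speed:
  assumes "s \<in> I" "t \<in> J" "(f has_vector_derivative f') (at t within J)"
  shows "mink (vector_derivative (\<lambda>t'. F s t') (at t within J))
    (associated_curve I (\<lambda>s'. F s' t) s) = f' / f t"
proof -
  have "((\<lambda>t'. f t' *\<^sub>R X s) has_vector_derivative f' *\<^sub>R X s) (at t within J)"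
    by (rule bounded_linear.has_vector_derivative[OF bounded_linear_scaleR_left assms(3)])
  then have "((\<lambda>t'. F s t') has_vector_derivative f' *\<^sub>R X s) (at t within J)"
    by (rule has_vector_derivative_transform[OF assms(2), rotated]) (simp add: F assms(1))
  then have "vector_derivative (\<lambda>t'. F s t') (at t within J) = f' *\<^sub>R X s"
    by (rule vector_derivative_within[OF nondegenerate_interval_nontrivial[OF J(1) assms(2)]])
  moreover have "associated_curve I (\<lambda>s'. F s' t) s = (1 / f t) *\<^sub>R Y s"
    by (rule associated_curve_homothety) (simp_all add: f_pos F assms)
  ultimately show ?thesis
    using mink_XY[OF assms(1)] by (simp add: mink.scaleR_left mink.scaleR_right)
qed

text \<open>Differentiability of \<open>f\<close> is not assumed. It is recovered from smoothness of
  the family, because \<open>f t\<close> is the product of \<open>F s0 t\<close> with the fixed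
  vector \<open>Y s0\<close>.\<close>

lemma CF_solution_f_deriv:
  assumes "CF_solution I J F X" "t \<in> J"
  obtains f' where "(f has_vector_derivative f') (at t within J)" "\<And>s. s \<in> I \<Longrightarrow> f t * f' = \<kappa> s"
proof -
  obtain s0 where s0: "s0 \<in> I" using I_nonempty by auto
  have sf: "smooth_family I J F"
    and flow: "\<And>s. s \<in> I \<Longrightarrow> mink (vector_derivative (\<lambda>t'. F s t') (at t within J))
         (associated_curve I (\<lambda>s'. F s' t) s) = curvature I (\<lambda>s'. F s' t) s"
    using assms by (auto simp: CF_solution_def spacelike_family_def)
  define f' where "f' = mink (vector_derivative (\<lambda>t'. F s0 t') (at t within J)) (Y s0)"
  have "((\<lambda>t. mink (F s0 t) (Y s0)) has_vector_derivative f') (at t within J)"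
    unfolding f'_def
    by (intro bounded_linear.has_vector_derivative[OF mink.bounded_linear_left]
        smooth_family_has_vector_derivative[OF sf J(1) s0 assms(2)])
  then have f': "(f has_vector_derivative f') (at t within J)"
    by (rule has_vector_derivative_transform[OF assms(2), rotated])
      (simp add: F s0 mink.scaleR_left mink_XY)
  have "f t * f' = \<kappa> s" if s: "s \<in> I" for s
    using flow[OF s] f_pos[OF assms(2)]
    unfolding flow_speed[OF s assms(2) f'] curvature_F[OF s assms(2)]
    by (simp add: field_simps power2_eq_square)
  with f' show ?thesis by (rule that)
qed

lemma CF_solution_iff:
  "CF_solution I J F X \<longleftrightarrow>
    (\<exists>c. (\<forall>s\<in>I. \<kappa> s = c) \<and> (\<forall>t\<in>J. f t = sqrt (2 * c * t + 1)))"
proof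
  assume CF: "CF_solution I J F X"
  \<comment> \<open>At time 0 the product \<open>f t * f'\<close> has one value for all
    \<open>s\<close>, so the curvature is constant.\<close>
  obtain c where c: "\<And>s. s \<in> I \<Longrightarrow> \<kappa> s = c"
    using CF_solution_f_deriv[OF CF J(2)] by metis
  have "((\<lambda>t. (f t)\<^sup>2 - 2 * c * t) has_field_derivative 0) (at t within J)" if t: "t \<in> J" for t
  proof -
    obtain f' where f': "(f has_vector_derivative f') (at t within J)" "f t * f' = c"
      using CF_solution_f_deriv[OF CF t] c I_nonempty by (metis ex_in_conv)
    note f'(1)[folded has_real_derivative_iff_has_vector_derivative, derivative_intros]
    show ?thesis
      using f'(2) by (auto intro!: derivative_eq_intros)
  qed
  moreover have "convex J"
    using J by (simp add: nondegenerate_interval_def is_interval_convex)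
  ultimately have "\<exists>d. \<forall>t\<in>J. (f t)\<^sup>2 - 2 * c * t = d"
    by (intro has_field_derivative_zero_constant)
  then obtain d where d: "\<And>t. t \<in> J \<Longrightarrow> (f t)\<^sup>2 - 2 * c * t = d" by blast
  have "d = 1" using d[OF J(2)] f0 by simp
  \<comment> \<open>Positivity of \<open>f\<close> selects the positive root.\<close>
  then have "f t = sqrt (2 * c * t + 1)" if "t \<in> J" for t
    using d[OF that] f_pos[OF that] by (intro real_sqrt_unique[symmetric]) auto
  with c show "\<exists>c. (\<forall>s\<in>I. \<kappa> s = c) \<and> (\<forall>t\<in>J. f t = sqrt (2 * c * t + 1))" by auto
next
  assume "\<exists>c. (\<forall>s\<in>I. \<kappa> s = c) \<and> (\<forall>t\<in>J. f t = sqrt (2 * c * t + 1))"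
  then obtain c where c: "\<And>s. s \<in> I \<Longrightarrow> \<kappa> s = c"
    and f: "\<And>t. t \<in> J \<Longrightarrow> f t = sqrt (2 * c * t + 1)" by auto
  \<comment> \<open>In Isabelle \<open>sqrt\<close> is an odd function on all reals, so a positive
    value of it means a positive radicand.\<close>
  have pos: "2 * c * t + 1 > 0" if "t \<in> J" for t
    using f_pos[OF that] f[OF that] by simp
  have "smooth_family I J F"
    by (rule smooth_family_scaleR[OF smooth smooth_curve_sqrt_affine[OF pos f] F])
  moreover have "spacelike_curve I (\<lambda>s. F s t)" if "t \<in> J" for t
    using that by (intro spacelike_homothety[of "f t"]) (simp_all add: f_pos F)
  moreover have "F s t \<in> light_cone_plus" if "s \<in> I" "t \<in> J" for s t
    using that plus by (auto simp: F light_cone_plus_scaleR f_pos)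
  ultimately have "spacelike_family I J F"
    unfolding spacelike_family_def using nondegenerate J by auto
  moreover have "mink (vector_derivative (\<lambda>t'. F s t') (at t within J))
      (associated_curve I (\<lambda>s'. F s' t) s) = curvature I (\<lambda>s'. F s' t) s"
    if s: "s \<in> I" and t: "t \<in> J" for s t
  proof -
    have "((\<lambda>t. sqrt (2 * c * t + 1)) has_vector_derivative c / f t) (at t within J)"
      unfolding has_real_derivative_iff_has_vector_derivative[symmetric]
      using pos[OF t] by (auto intro!: derivative_eq_intros simp: f[OF t] field_simps)
    then have "(f has_vector_derivative c / f t) (at t within J)"
      by (rule has_vector_derivative_transform[OF t f, rotated])
    from flow_speed[OF s t this] show ?thesis
      by (simp add: curvature_F s t c power2_eq_square)
  qed
  moreover have "F s 0 = X s" if "s \<in> I" for s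
    using that J by (simp add: F f0)
  ultimately show "CF_solution I J F X"
    unfolding CF_solution_def by auto
qed

end

section \<open>Maximal time interval and collapse\<close>

lemma CF_solution_avoids_zero:
  assumes CF: "CF_solution I J' G X" and s: "s \<in> I" and t0: "t0 \<in> J'"
    and lim: "((\<lambda>t. G s t) \<longlongrightarrow> 0) (at t0 within J)" and J: "J \<subseteq> J'" "at t0 within J \<noteq> bot"
  shows False
proof -
  have "smooth_family I J' G" "nondegenerate_interval J'" "G s t0 \<in> light_cone"
    using CF s t0 by (auto simp: CF_solution_def spacelike_family_def light_cone_plus_def)
  \<comment> \<open>Smoothness in time makes \<open>G s\<close> continuous at \<open>t0\<close>, so
    a limit along \<open>J\<close> must be its value there, a point of the cone.\<close>
  then have "((\<lambda>t. G s t) \<longlongrightarrow> G s t0) (at t0 within J')"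
    using has_vector_derivative_continuous[OF smooth_family_has_vector_derivative] s t0
    by (simp add: continuous_within)
  then have "((\<lambda>t. G s t) \<longlongrightarrow> G s t0) (at t0 within J)"
    using J(1) by (rule tendsto_within_subset)
  with lim J(2) have "G s t0 = 0"
    by (intro tendsto_unique)
  with \<open>G s t0 \<in> light_cone\<close> show False by (simp add: light_cone_def)
qed

context homothetic_evolution
begin

text \<open>A solution on the whole half-line exists, so a maximal \<open>J\<close> fills it.
  Conversely, any extension beyond the half-line contains its endpoint, which is finite as
  \<open>c\<close> is nonzero, and there the curves shrink to the origin.\<close>

lemma maximal_CF_solution_iff:
  assumes CF: "CF_solution I J F X" and c: "\<And>s. s \<in> I \<Longrightarrow> \<kappa> s = c" "c \<noteq> 0"
  shows "maximal_CF_solution I J F X \<longleftrightarrow> J = {t. 2 * c * t + 1 > 0}"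
proof -
  define U where "U = {t. 2 * c * t + 1 > 0}"
  define t0 where "t0 = - 1 / (2 * c)"
  have U_cases: "U = {..<t0} \<or> U = {t0<..}"
    using affine_positive_ray[OF c(2)] by (auto simp: U_def t0_def split: if_splits)
  have f: "f t = sqrt (2 * c * t + 1)" if "t \<in> J" for t
    using CF_solution_iff CF c I_nonempty that by (metis ex_in_conv)
  have JU: "J \<subseteq> U"
    using f f_pos by (auto simp: U_def)
  have U: "nondegenerate_interval U"
    using U_cases by (auto simp: nondegenerate_interval_def interior_open)
  have U0: "0 \<in> U" by (simp add: U_def)
  show ?thesis
    unfolding U_def[symmetric]
  proof
    define G where "G s t = sqrt (2 * c * t + 1) *\<^sub>R X s" for s t
    \<comment> \<open>The same square root formula on all of \<open>U\<close> gives a solution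
      extending \<open>F\<close>.\<close>
    interpret ext: homothetic_evolution I X U "\<lambda>t. sqrt (2 * c * t + 1)" G
      by unfold_locales (use plus U U0 in \<open>auto simp: U_def G_def\<close>)
    have "CF_solution I U G X"
      using ext.CF_solution_iff c by auto
    moreover have "G s t = F s t" if "s \<in> I" "t \<in> J" for s t
      using that by (simp add: G_def F f)
    moreover assume "maximal_CF_solution I J F X"
    ultimately show "J = U"
      using JU unfolding maximal_CF_solution_def by blast
  next
    assume JU_eq: "J = U"
    have "J' = J" if CF': "CF_solution I J' G X" and sub: "J \<subseteq> J'"
      and agree: "\<forall>s\<in>I. \<forall>t\<in>J. G s t = F s t" for J' G
    proof (rule ccontr)
      assume "J' \<noteq> J"
      with sub obtain x where x: "x \<in> J'" "x \<notin> U" unfolding JU_eq by auto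
      have J': "is_interval J'" "0 \<in> J'"
        using CF' by (auto simp: CF_solution_def spacelike_family_def nondegenerate_interval_def)
      \<comment> \<open>The endpoint separates 0 from any time outside \<open>U\<close>, so an
        interval containing both contains \<open>t0\<close>.\<close>
      have "x \<le> t0 \<and> t0 \<le> 0 \<or> 0 \<le> t0 \<and> t0 \<le> x"
        using U_cases U0 x by auto
      then have t0: "t0 \<in> J'"
        using J' x unfolding is_interval_1 by metis
      obtain s where s: "s \<in> I" using I_nonempty by auto
      have "((\<lambda>t. sqrt (2 * c * t + 1) *\<^sub>R X s) \<longlongrightarrow> sqrt (2 * c * t0 + 1) *\<^sub>R X s) (at t0 within J)"
        by (intro tendsto_intros)
      then have "((\<lambda>t. sqrt (2 * c * t + 1) *\<^sub>R X s) \<longlongrightarrow> 0) (at t0 within J)"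
        using c(2) by (simp add: t0_def)
      moreover have "eventually (\<lambda>t. sqrt (2 * c * t + 1) *\<^sub>R X s = G s t) (at t0 within J)"
        unfolding eventually_at_filter using agree s by (intro always_eventually) (simp add: F f)
      ultimately have "((\<lambda>t. G s t) \<longlongrightarrow> 0) (at t0 within J)"
        by (rule Lim_transform_eventually)
      moreover have "at t0 within J \<noteq> bot"
        unfolding JU_eq using U_cases by auto
      ultimately show False
        using CF_solution_avoids_zero[OF CF' s t0 _ sub] by blast
    qed
    with CF show "maximal_CF_solution I J F X"
      unfolding maximal_CF_solution_def by blast
  qed
qed

lemma collapses_into_origin:
  assumes CF: "CF_solution I J F X" and c: "\<And>s. s \<in> I \<Longrightarrow> \<kappa> s = c" "c \<noteq> 0"
    and J_eq: "J = {..< - 1 / (2 * c)}"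
  shows "collapses_into_origin I F (- 1 / (2 * c))"
  unfolding collapses_into_origin_def
proof
  define t0 where "t0 = - 1 / (2 * c)"
  fix s assume s: "s \<in> I"
  have f: "f t = sqrt (2 * c * t + 1)" if "t \<in> J" for t
    using CF_solution_iff CF c I_nonempty that by (metis ex_in_conv)
  have "((\<lambda>t. sqrt (2 * c * t + 1) *\<^sub>R X s) \<longlongrightarrow> sqrt (2 * c * t0 + 1) *\<^sub>R X s) (at_left t0)"
    by (intro tendsto_intros)
  then have "((\<lambda>t. sqrt (2 * c * t + 1) *\<^sub>R X s) \<longlongrightarrow> 0) (at_left t0)"
    using c(2) by (simp add: t0_def)
  \<comment> \<open>All times to the left of \<open>t0\<close> belong to \<open>J\<close>, where
    \<open>F\<close> is given by the formula.\<close>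
  moreover have "eventually (\<lambda>t. sqrt (2 * c * t + 1) *\<^sub>R X s = F s t) (at_left t0)"
    unfolding eventually_at_filter
    using s by (intro always_eventually) (simp add: F f J_eq t0_def)
  ultimately show "((\<lambda>t. F s t) \<longlongrightarrow> 0) (at_left (- 1 / (2 * c)))"
    unfolding t0_def by (rule Lim_transform_eventually)
qed

end

text \<open>Maximality of \<open>J\<close> is rendered as an equivalence with \<open>J\<close> being
  the stated half-line; the competing extensions are arbitrary solutions, not only homothetic
  ones.\<close>

theorem theorem1p2:
  fixes X :: "real \<Rightarrow> real ^ 3" and k f :: "real \<Rightarrow> real" and I J :: "real set"
    and F :: "real \<Rightarrow> real \<Rightarrow> real ^ 3"
  assumes "arc_length_curve I X" and "X ` I \<subseteq> light_cone_plus"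
    and "\<And>s. s \<in> I \<Longrightarrow> k s = arc_length_curvature I X s"
    and "\<exists>s\<in>I. k s \<noteq> 0"
    and "nondegenerate_interval J" and "0 \<in> J"
    and "\<And>t. t \<in> J \<Longrightarrow> f t > 0" and "f 0 = 1"
    and "\<And>s t. s \<in> I \<Longrightarrow> t \<in> J \<Longrightarrow> F s t = f t *\<^sub>R X s"
  shows "(CF_solution I J F X \<longleftrightarrow>
           (\<exists>c. (\<forall>s\<in>I. k s = c) \<and>
                (\<forall>t\<in>J. f t = sqrt (2 * c * t + 1)) \<and>
                (\<forall>s\<in>I. \<forall>t\<in>J. curvature I (\<lambda>s'. F s' t) s = c / (2 * c * t + 1))))
       \<and> (\<forall>c. CF_solution I J F X \<and> (\<forall>s\<in>I. k s = c) \<and> c < 0 \<longrightarrow>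
            ellipse_of_curvature I X c \<and>
            (maximal_CF_solution I J F X \<longleftrightarrow> J = {..< - 1 / (2 * c)}) \<and>
            (maximal_CF_solution I J F X \<longrightarrow>
               ancient_CF_solution I J F X \<and> collapses_into_origin I F (- 1 / (2 * c))))
       \<and> (\<forall>c. CF_solution I J F X \<and> (\<forall>s\<in>I. k s = c) \<and> c > 0 \<longrightarrow>
            hyperbola_of_curvature I X c \<and>
            (maximal_CF_solution I J F X \<longleftrightarrow> J = {- 1 / (2 * c) <..}))"
proof -
  interpret homothetic_evolution I X J f F
    using assms by unfold_locales auto
  have k: "k s = \<kappa> s" if "s \<in> I" for s
    using assms(3)[OF that] arc_length_curvature_eq[OF that] by simp
  have k_const: "(\<forall>s\<in>I. k s = c) \<longleftrightarrow> (\<forall>s\<in>I. \<kappa> s = c)" for c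
    using k by simp
  have curv: "curvature I (\<lambda>s'. F s' t) s = c / (2 * c * t + 1)"
    if "\<forall>s\<in>I. \<kappa> s = c" "\<forall>t\<in>J. f t = sqrt (2 * c * t + 1)" "s \<in> I" "t \<in> J" for c s t
  proof -
    \<comment> \<open>Squaring the formula for \<open>f\<close> turns the quotient in
      \<open>curvature_F\<close> into the asserted one.\<close>
    have "(f t)\<^sup>2 = 2 * c * t + 1"
      using that f_pos[OF that(4)] by auto
    with that show ?thesis by (simp add: curvature_F)
  qed
  have "CF_solution I J F X \<longleftrightarrow>
      (\<exists>c. (\<forall>s\<in>I. k s = c) \<and> (\<forall>t\<in>J. f t = sqrt (2 * c * t + 1)) \<and>
        (\<forall>s\<in>I. \<forall>t\<in>J. curvature I (\<lambda>s'. F s' t) s = c / (2 * c * t + 1)))"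
    unfolding CF_solution_iff k_const using curv by blast
  moreover have "ellipse_of_curvature I X c \<and>
      (maximal_CF_solution I J F X \<longleftrightarrow> J = {..< - 1 / (2 * c)}) \<and>
      (maximal_CF_solution I J F X \<longrightarrow>
        ancient_CF_solution I J F X \<and> collapses_into_origin I F (- 1 / (2 * c)))"
    if CF: "CF_solution I J F X" and c: "\<forall>s\<in>I. k s = c" "c < 0" for c
  proof -
    have \<kappa>: "\<kappa> s = c" if "s \<in> I" for s using c(1) that by (simp add: k)
    have max: "maximal_CF_solution I J F X \<longleftrightarrow> J = {..< - 1 / (2 * c)}"
      using maximal_CF_solution_iff[OF CF \<kappa>] affine_positive_ray[of c] c(2) by simp
    then show ?thesis
      using constant_curvature_conic[OF plus \<kappa>] c(2) CF collapses_into_origin[OF CF \<kappa>]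
      by (auto simp: ellipse_of_curvature_def ancient_CF_solution_def)
  qed
  moreover have "hyperbola_of_curvature I X c \<and>
      (maximal_CF_solution I J F X \<longleftrightarrow> J = {- 1 / (2 * c) <..})"
    if CF: "CF_solution I J F X" and c: "\<forall>s\<in>I. k s = c" "c > 0" for c
  proof -
    have \<kappa>: "\<kappa> s = c" if "s \<in> I" for s using c(1) that by (simp add: k)
    show ?thesis
      using constant_curvature_conic[OF plus \<kappa>] maximal_CF_solution_iff[OF CF \<kappa>]
        affine_positive_ray[of c] c(2)
      by (simp add: hyperbola_of_curvature_def)
  qed
  ultimately show ?thesis by blast
qed

end
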